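(* The diagonal Borel transform $\Psi_A(t)$, $A=\alpha^2$, satisfies: (i) (Rigidity) $\Psi_A=\Lambda_1\cosh 2\alpha t+\Lambda_0$ with $\Lambda_0(t),\Lambda_1(t)$ independent of $\alpha$; coefficientwise, for $k\ge1$, $[A^k]\Psi_A=\dfrac{2^{2k-1}}{(2k)!}\,t^{2k-2}\,[A^1]\Psi_A$. (ii) (Chebyshev) $\Psi_{1/4}\equiv0$, i.e. there is no correction at $\alpha=\beta=\pm\frac12$. (iii) (Legendre) $\Psi_0(t)=\frac12\bigl(\operatorname{sech}t-\tanh\frac t2-1\bigr)$.
   Context: For $\nu\in\mathbb C$ and $k\ge0$ let $a_k(\nu)=\dfrac{(\frac12+\nu)_k(\frac12-\nu)_k}{(-2)^k k!}$ ($(x)_k$ is the Pochhammer symbol). Let $p=1+i$, $q=1-i$. On the diagonal $\beta=\alpha$ put $G_n=\sum_{l=0}^n a_l(\alpha)a_{n-l}(\alpha)p^lq^{n-l}$ and $F(Z)=\sum_{n\ge0}\dfrac{G_n}{(Z-1)\cdots(Z-n)}$, a formal power series in $Z^{-1}$ (each summand expanded at $Z=\infty$) with constant term $1$. Write $\log F=\sum_{n\ge1}L_n^{\mathrm{diag}}Z^{-n}$; each $L_n^{\mathrm{diag}}$ is a polynomial in $A=\alpha^2$. Set $\Psi_A(t)=\sum_{n\ge1}\dfrac{L_n^{\mathrm{diag}}}{(n-1)!}t^n$. $\Psi_{1/4}$ and $\Psi_0$ denote its values at $A=\frac14$ and $A=0$; $[A^k]$ is coefficient extraction. In (i), $\Lambda_0,\Lambda_1$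 are formal Laurent series in $t$. *)

theory Defs
  imports Complex_Main "HOL-Computational_Algebra.Computational_Algebra"
begin

definition a_coef :: "complex \<Rightarrow> nat \<Rightarrow> complex" where
  "a_coef \<nu> k = pochhammer (1/2 + \<nu>) k * pochhammer (1/2 - \<nu>) k / ((-2) ^ k * fact k)"

definition p_const :: complex where "p_const = 1 + \<i>"
definition q_const :: complex where "q_const = 1 - \<i>"

definition G_diag :: "complex \<Rightarrow> nat \<Rightarrow> complex" where
  "G_diag \<alpha> n = (\<Sum>l=0..n. a_coef \<alpha> l * a_coef \<alpha> (n - l) * p_const ^ l * q_const ^ (n - l))"

(* The series variable is Z^{-1}: the expansion of 1 / (Z - j) at infinity is X / (1 - j X).
   The infinite sum converges in the X-adic topology, see F_diag_sums. *)
definition F_diag_term :: "complex \<Rightarrow> nat \<Rightarrow> complex fps" where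
  "F_diag_term \<alpha> n = fps_const (G_diag \<alpha> n) * (\<Prod>j=1..n. fps_X / (1 - of_nat j * fps_X))"

definition F_diag :: "complex \<Rightarrow> complex fps" where
  "F_diag \<alpha> = (\<Sum>n. F_diag_term \<alpha> n)"

(* fps_ln 1 is the series of log (1 + X), and F_diag has constant term 1. *)
definition log_F_diag :: "complex \<Rightarrow> complex fps" where
  "log_F_diag \<alpha> = fps_ln 1 oo (F_diag \<alpha> - 1)"

(* The coefficients of log F as polynomials in A = \<alpha>^2;
   existence and uniqueness are proved in L_diag_ex1. *)
definition L_diag :: "nat \<Rightarrow> complex poly" where
  "L_diag n = (THE P. \<forall>\<alpha>. poly P (\<alpha>\<^sup>2) = fps_nth (log_F_diag \<alpha>) n)"

(* A power series in t with coefficients in C[A]. *)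
definition Psi :: "complex poly fps" where
  "Psi = Abs_fps (\<lambda>n. if n = 0 then 0 else smult (1 / fact (n - 1)) (L_diag n))"

definition Psi_at :: "complex \<Rightarrow> complex fps" where
  "Psi_at A = Abs_fps (\<lambda>n. poly (fps_nth Psi n) A)"

(* [A^k] Psi *)
definition Psi_coeff :: "nat \<Rightarrow> complex fps" where
  "Psi_coeff k = Abs_fps (\<lambda>n. coeff (fps_nth Psi n) k)"

(* The series in t of cosh (c t) and sinh (c t). *)
definition fps_cosh :: "complex \<Rightarrow> complex fps" where
  "fps_cosh c = fps_const (1/2) * (fps_exp c + fps_exp (- c))"

definition fps_sinh :: "complex \<Rightarrow> complex fps" where
  "fps_sinh c = fps_const (1/2) * (fps_exp c - fps_exp (- c))"


text \<open>Convergence of the series defining \<open>F_diag\<close>.\<close>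

lemma F_diag_term_altdef:
  "F_diag_term \<alpha> n =
     fps_const (G_diag \<alpha> n) * (fps_X ^ n * (\<Prod>j=1..n. inverse (1 - of_nat j * fps_X)))"
proof -
  have "(\<Prod>j=1..n. fps_X / (1 - of_nat j * fps_X :: complex fps))
          = (\<Prod>j=1..n. fps_X * inverse (1 - of_nat j * fps_X))"
    by (intro prod.cong refl fps_divide_unit) simp
  then show ?thesis
    by (simp add: F_diag_term_def prod.distrib)
qed

lemma F_diag_term_nth_eq_0: "m < n \<Longrightarrow> fps_nth (F_diag_term \<alpha> n) m = 0"
  by (simp add: F_diag_term_altdef fps_X_power_mult_nth)

lemma F_diag_sums': 
  "F_diag_term \<alpha> sums Abs_fps (\<lambda>m. \<Sum>n\<le>m. fps_nth (F_diag_term \<alpha> n) m)"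
  unfolding sums_def
proof (rule tendsto_fpsI)
  fix m
  show "eventually (\<lambda>N. fps_nth (\<Sum>n<N. F_diag_term \<alpha> n) m =
          fps_nth (Abs_fps (\<lambda>m. \<Sum>n\<le>m. fps_nth (F_diag_term \<alpha> n) m)) m) sequentially"
    using eventually_gt_at_top[of m]
  proof eventually_elim
    case (elim N)
    have "(\<Sum>n<N. fps_nth (F_diag_term \<alpha> n) m) = (\<Sum>n\<le>m. fps_nth (F_diag_term \<alpha> n) m)"
      using elim by (intro sum.mono_neutral_right) (auto intro: F_diag_term_nth_eq_0)
    then show ?case by (simp add: fps_sum_nth)
  qed
qed

lemma F_diag_sums: "F_diag_term \<alpha> sums F_diag \<alpha>"
  using F_diag_sums' unfolding F_diag_def by (simp add: sums_iff)

lemma F_diag_nth: "fps_nth (F_diag \<alpha>) m = (\<Sum>n\<le>m. fps_nth (F_diag_term \<alpha> n) m)"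
  unfolding F_diag_def sums_unique[OF F_diag_sums'[of \<alpha>], symmetric] by simp

lemma F_diag_nth_0: "fps_nth (F_diag \<alpha>) 0 = 1"
  by (simp add: F_diag_nth F_diag_term_def G_diag_def a_coef_def)


text \<open>The coefficients of \<open>log_F_diag\<close> are polynomials in \<open>\<alpha>\<^sup>2\<close>.\<close>

definition poly_in_square :: "(complex \<Rightarrow> complex) \<Rightarrow> bool" where
  "poly_in_square f \<longleftrightarrow> (\<exists>P. \<forall>\<alpha>. poly P (\<alpha>\<^sup>2) = f \<alpha>)"

lemma poly_in_square_const: "poly_in_square (\<lambda>_. c)"
  unfolding poly_in_square_def by (intro exI[of _ "[:c:]"]) simp

lemma poly_in_square_add:
  "poly_in_square f \<Longrightarrow> poly_in_square g \<Longrightarrow> poly_in_square (\<lambda>\<alpha>. f \<alpha> + g \<alpha>)"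
  unfolding poly_in_square_def by (metis poly_add)

lemma poly_in_square_diff:
  "poly_in_square f \<Longrightarrow> poly_in_square g \<Longrightarrow> poly_in_square (\<lambda>\<alpha>. f \<alpha> - g \<alpha>)"
  unfolding poly_in_square_def by (metis poly_diff)

lemma poly_in_square_mult:
  "poly_in_square f \<Longrightarrow> poly_in_square g \<Longrightarrow> poly_in_square (\<lambda>\<alpha>. f \<alpha> * g \<alpha>)"
  unfolding poly_in_square_def by (metis poly_mult)

lemma poly_in_square_sum:
  "(\<And>i. i \<in> I \<Longrightarrow> poly_in_square (f i)) \<Longrightarrow> poly_in_square (\<lambda>\<alpha>. \<Sum>i\<in>I. f i \<alpha>)"
  by (induction I rule: infinite_finite_induct)
     (auto intro: poly_in_square_const poly_in_square_add)

lemma poly_in_square_a_coef: "poly_in_square (\<lambda>\<alpha>. a_coef \<alpha> k)"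
proof (induction k)
  case 0
  then show ?case by (simp add: a_coef_def poly_in_square_const)
next
  case (Suc k)
  define c :: complex where "c = -2 * of_nat (Suc k)"
  have *: "poly_in_square (\<lambda>\<alpha>. 1 / c * ((1/2 + of_nat k)\<^sup>2 - \<alpha>\<^sup>2))"
    unfolding poly_in_square_def
    by (intro exI[of _ "smult (1 / c) [:(1/2 + of_nat k)\<^sup>2, -1:]"])
       (simp only: poly_smult poly_pCons poly_0, simp)
  have "a_coef \<alpha> (Suc k) = a_coef \<alpha> k * (1 / c * ((1/2 + of_nat k)\<^sup>2 - \<alpha>\<^sup>2))" for \<alpha>
  proof -
    have "(1/2 + of_nat k)\<^sup>2 - \<alpha>\<^sup>2 = (1/2 + \<alpha> + of_nat k) * (1/2 - \<alpha> + of_nat k)"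
      by (simp add: power2_eq_square algebra_simps)
    moreover have "(-2) ^ Suc k * fact (Suc k) = (-2) ^ k * fact k * c"
      by (simp only: c_def power_Suc fact_Suc mult_ac)
    ultimately show ?thesis
      by (simp only: a_coef_def pochhammer_Suc times_divide_times_eq mult_1_right mult_1_left
            times_divide_eq_left times_divide_eq_right divide_divide_eq_left mult_ac)
  qed
  with poly_in_square_mult[OF Suc *] show ?case by simp
qed

lemma poly_in_square_F_diag: "poly_in_square (\<lambda>\<alpha>. fps_nth (F_diag \<alpha>) m)"
  unfolding F_diag_nth F_diag_term_def fps_mult_left_const_nth G_diag_def
  by (intro poly_in_square_sum poly_in_square_mult poly_in_square_a_coef poly_in_square_const)

lemma poly_in_square_power:
  assumes "\<And>m. poly_in_square (\<lambda>\<alpha>. fps_nth (f \<alpha>) m)"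
  shows   "poly_in_square (\<lambda>\<alpha>. fps_nth (f \<alpha> ^ i) m)"
proof (induction i arbitrary: m)
  case 0
  then show ?case by (simp add: poly_in_square_const)
next
  case (Suc i)
  then show ?case
    unfolding power_Suc fps_mult_nth by (intro poly_in_square_sum poly_in_square_mult assms)
qed

lemma poly_in_square_log_F_diag: "poly_in_square (\<lambda>\<alpha>. fps_nth (log_F_diag \<alpha>) n)"
  unfolding log_F_diag_def fps_compose_nth
  by (intro poly_in_square_sum poly_in_square_mult poly_in_square_const poly_in_square_power)
     (auto intro: poly_in_square_diff poly_in_square_F_diag poly_in_square_const)

lemma L_diag_ex1: "\<exists>!P. \<forall>\<alpha>. poly P (\<alpha>\<^sup>2) = fps_nth (log_F_diag \<alpha>) n"
proof (rule ex_ex1I)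
  show "\<exists>P. \<forall>\<alpha>. poly P (\<alpha>\<^sup>2) = fps_nth (log_F_diag \<alpha>) n"
    using poly_in_square_log_F_diag[of n] by (simp add: poly_in_square_def)
next
  fix P Q
  assume "\<forall>\<alpha>. poly P (\<alpha>\<^sup>2) = fps_nth (log_F_diag \<alpha>) n"
    and "\<forall>\<alpha>. poly Q (\<alpha>\<^sup>2) = fps_nth (log_F_diag \<alpha>) n"
  then have "poly P ((csqrt A)\<^sup>2) = poly Q ((csqrt A)\<^sup>2)" for A by metis
  then have "poly P = poly Q" by (intro ext) simp
  then show "P = Q" by (simp only: poly_eq_poly_eq_iff)
qed

lemma poly_L_diag: "poly (L_diag n) (\<alpha>\<^sup>2) = fps_nth (log_F_diag \<alpha>) n"
  using theI'[OF L_diag_ex1[of n]] unfolding L_diag_def by blast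

end

theory Submission
  imports Defs
begin

text \<open>
  With \<open>Z\<close> the variable inverse to that of the series, \<open>\<Gamma>(Z) F(Z)\<close> is formally the Mellin transform
  \<open>\<integral> s\<^sup>Z P(s) ds\<close> of a product \<open>P\<close> of two modified Bessel functions, expanded at \<open>s = \<infinity>\<close>. Indeed
  \<open>s\<^sup>-\<^sup>1\<^sup>/\<^sup>2 e\<^sup>-\<^sup>s\<^sup>/\<^sup>w (\<Sum>k. a\<^sub>k(\<alpha>) w\<^sup>k s\<^sup>-\<^sup>k)\<close> is, up to a constant, the expansion of \<open>K\<^sub>\<alpha>(s/w)\<close>; and since
  \<open>1/p + 1/q = 1\<close>, the product for \<open>w = p\<close> and \<open>w = q\<close> is \<open>P = s\<^sup>-\<^sup>1 e\<^sup>-\<^sup>s (\<Sum>n. G\<^sub>n s\<^sup>-\<^sup>n)\<close>, while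
  \<open>s\<^sup>Z\<^sup>-\<^sup>1\<^sup>-\<^sup>n e\<^sup>-\<^sup>s\<close> integrates to \<open>\<Gamma>(Z) / ((Z - 1) \<cdots> (Z - n))\<close>.

  Let \<open>\<theta> = s d/ds\<close>. Each factor \<open>y\<close> satisfies \<open>\<theta>\<^sup>2 y = (s\<^sup>2/w\<^sup>2 + \<alpha>\<^sup>2) y\<close>, and \<open>1/p\<^sup>2 = - 1/q\<^sup>2\<close>. Thanks
  to the opposite signs the mixed terms can be eliminated in two steps (\<open>product_ode\<close>), leaving
  \<open>(\<theta> - 2) \<theta> (\<theta>\<^sup>2 - 4\<alpha>\<^sup>2) P = s\<^sup>4 P\<close>. Under the Mellin transform \<open>\<theta>\<close> becomes multiplication by
  \<open>-(Z + 1)\<close> and multiplication by \<open>s\<^sup>4\<close> becomes \<open>Z \<mapsto> Z + 4\<close>, so that, after cancelling common factors,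
  \<open>Z (Z + 2) F(Z + 4) = (Z + 1 + 2\<alpha>) (Z + 1 - 2\<alpha>) F(Z)\<close> (\<open>F_diag_functional_equation\<close>). No convergence
  is involved: the transform is defined termwise on formal series.

  Taking logarithms turns this into a linear difference equation for \<open>log F\<close>, and the Borel transform
  \<open>Z\<^sup>-\<^sup>n \<mapsto> t\<^sup>n / (n - 1)!\<close> turns \<open>Z \<mapsto> Z + 4\<close> into multiplication by \<open>e\<^sup>-\<^sup>4\<^sup>t\<close> and \<open>log (1 + a/Z)\<close> into
  \<open>1 - e\<^sup>-\<^sup>a\<^sup>t\<close>. The result, \<open>Psi_at_functional_equation\<close>, is
  \<open>\<Psi>\<^sub>A(t) (e\<^sup>-\<^sup>4\<^sup>t - 1) = 1 + e\<^sup>-\<^sup>2\<^sup>t - 2 e\<^sup>-\<^sup>t cosh 2\<alpha>t\<close>, in other words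
  \<open>\<Psi>\<^sub>A(t) = e\<^sup>t (cosh 2\<alpha>t - cosh t) / sinh 2t\<close>. It is affine in \<open>cosh 2\<alpha>t\<close>, vanishes at \<open>\<alpha> = 1/2\<close>, and
  simplifies at \<open>\<alpha> = 0\<close>; comparing powers of \<open>A\<close> gives the coefficientwise form of rigidity.\<close>

section \<open>Euler operators on Laurent series\<close>

text \<open>
  The action of \<open>\<theta> = s d/ds\<close> on the factor \<open>f\<close> of \<open>s\<^sup>-\<^sup>a e\<^sup>-\<^sup>b\<^sup>s f\<close>, where \<open>f\<close> is a Laurent series in
  \<open>X = 1/s\<close> (so \<open>\<theta> = - X d/dX\<close>). This keeps the exponential outside the formal series.\<close>

definition twisted_euler :: "complex \<Rightarrow> complex \<Rightarrow> complex fls \<Rightarrow> complex fls" where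
  "twisted_euler a b f = - (fls_X * fls_deriv f) - fls_const a * f - fls_const b * (fls_X_inv * f)"

lemma twisted_euler_nth [simp]:
  "fls_nth (twisted_euler a b f) n =
     - (of_int n + a) * fls_nth f n - b * fls_nth f (n + 1)"
  by (simp add: twisted_euler_def fls_X_times_conv_shift fls_X_inv_times_conv_shift algebra_simps)

lemma twisted_euler_add: "twisted_euler a b (f + g) = twisted_euler a b f + twisted_euler a b g"
  and twisted_euler_diff: "twisted_euler a b (f - g) = twisted_euler a b f - twisted_euler a b g"
  and twisted_euler_const_mult:
    "twisted_euler a b (fls_const c * f) = fls_const c * twisted_euler a b f"
  by (auto intro!: fls_eqI simp: algebra_simps)

text \<open>
  The Leibniz rule: the prefactors \<open>s\<^sup>-\<^sup>a e\<^sup>-\<^sup>b\<^sup>s\<close> multiply, so their exponents add.\<close>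

lemma twisted_euler_mult:
  "twisted_euler (a + a') (b + b') (f * g) =
     twisted_euler a b f * g + f * twisted_euler a' b' g"
  by (simp add: twisted_euler_def algebra_simps flip: fls_plus_const)

lemma twisted_euler_X_inv_square_mult:
  "twisted_euler a b (fls_X_inv\<^sup>2 * f) = fls_X_inv\<^sup>2 * (twisted_euler a b f + 2 * f)"
proof -
  have "twisted_euler 0 0 (fls_X_inv\<^sup>2) = 2 * fls_X_inv\<^sup>2"
    by (intro fls_eqI) (auto simp: fls_times_fps_to_fls simp flip: fls_const_numeral)
  with twisted_euler_mult[of 0 a 0 b "fls_X_inv\<^sup>2" f] show ?thesis
    by (simp add: algebra_simps)
qed

text \<open>
  Write \<open>'\<close> for the Euler derivative, \<open>P = y z\<close> and \<open>R = y z' - y' z\<close>. The equations give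
  \<open>P'' = 2 A P + 2 y' z'\<close> and, because their \<open>s\<^sup>2\<close>-terms are opposite, \<open>(y' z')' = A P' + c s\<^sup>2 R\<close> and
  \<open>R' = - 2 c s\<^sup>2 P\<close>. Hence \<open>(P'' - 4 A P)' = 2 c s\<^sup>2 R\<close>, and since \<open>(s\<^sup>2 R)' - 2 s\<^sup>2 R = s\<^sup>2 R'\<close>, applying
  \<open>\<theta> - 2\<close> eliminates \<open>R\<close>.\<close>

lemma product_ode:
  fixes y z :: "complex fls" and a b a' b' c A :: complex
  defines "D \<equiv> twisted_euler (a + a') (b + b')"
  assumes y: "twisted_euler a b (twisted_euler a b y) = (fls_const c * fls_X_inv\<^sup>2 + fls_const A) * y"
    and z: "twisted_euler a' b' (twisted_euler a' b' z) =
              (- fls_const c * fls_X_inv\<^sup>2 + fls_const A) * z"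
  defines "Q \<equiv> D (D (y * z)) - fls_const (4 * A) * (y * z)"
  shows "D (D Q) - fls_const 2 * D Q = - fls_const (4 * c\<^sup>2) * (fls_X_inv ^ 4 * (y * z))"
proof -
  define y' z' where "y' = twisted_euler a b y" and "z' = twisted_euler a' b' z"
  define R where "R = y * z' - y' * z"
  note leibniz = twisted_euler_mult[of a a' b b', folded D_def]
  have lin: "D (f + g) = D f + D g" "D (f - g) = D f - D g"
    "D (fls_const k * f) = fls_const k * D f" for f g k
    by (simp_all add: D_def twisted_euler_add twisted_euler_diff twisted_euler_const_mult)
  have P: "D (y * z) = y' * z + y * z'"
    by (simp add: leibniz y'_def z'_def)
  have mixed: "D (y' * z') = fls_const A * D (y * z) + fls_const c * (fls_X_inv\<^sup>2 * R)"
    unfolding P leibniz[of y' z'] y[folded y'_def] z[folded z'_def]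
    by (simp add: R_def y'_def[symmetric] z'_def[symmetric] y z algebra_simps)
  have R: "D R = - fls_const (2 * c) * (fls_X_inv\<^sup>2 * (y * z))"
    unfolding R_def lin leibniz
    by (simp add: y'_def[symmetric] z'_def[symmetric] y[folded y'_def] z[folded z'_def]
          algebra_simps flip: fls_const_mult_const)
  have "D (D (y * z)) = fls_const (2 * A) * (y * z) + fls_const 2 * (y' * z')"
    unfolding P lin leibniz
    by (simp add: y'_def[symmetric] z'_def[symmetric] y[folded y'_def] z[folded z'_def]
          algebra_simps flip: fls_const_mult_const)
  then have Q: "Q = fls_const 2 * (y' * z') - fls_const (2 * A) * (y * z)"
    by (simp add: Q_def algebra_simps flip: fls_const_mult_const)
  have DQ: "D Q = fls_const (2 * c) * (fls_X_inv\<^sup>2 * R)"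
    unfolding Q lin mixed by (simp add: algebra_simps flip: fls_const_mult_const)
  have "D (D Q) = fls_const (2 * c) * (fls_X_inv\<^sup>2 * (D R + 2 * R))"
    unfolding DQ lin by (simp add: D_def twisted_euler_X_inv_square_mult)
  then show ?thesis
    unfolding DQ R
    by (simp add: algebra_simps power2_eq_square power4_eq_xxxx flip: fls_const_mult_const)
qed

section \<open>The Bessel series and the differential equation of their product\<close>

text \<open>
  The asymptotic series of \<open>K\<^sub>\<alpha>(s/w)\<close> at \<open>s = \<infinity>\<close>, without the factor \<open>s\<^sup>-\<^sup>1\<^sup>/\<^sup>2 e\<^sup>-\<^sup>s\<^sup>/\<^sup>w\<close>.\<close>

definition bessel_series :: "complex \<Rightarrow> complex \<Rightarrow> complex fps" where
  "bessel_series \<alpha> w = Abs_fps (\<lambda>k. a_coef \<alpha> k * w ^ k)"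

lemma a_coef_Suc:
  "2 * of_nat (Suc k) * a_coef \<alpha> (Suc k) = (\<alpha>\<^sup>2 - (of_nat k + 1/2)\<^sup>2) * a_coef \<alpha> k"
proof -
  define d :: complex where "d = (-2) ^ k * fact k"
  define r where "r = pochhammer (1/2 + \<alpha>) k * pochhammer (1/2 - \<alpha>) k"
  define m :: complex where "m = of_nat (Suc k)"
  have "m \<noteq> 0" unfolding m_def by (rule of_nat_neq_0)
  have "d \<noteq> 0" by (simp add: d_def)
  have "a_coef \<alpha> (Suc k) = r * ((1/2 + \<alpha> + of_nat k) * (1/2 - \<alpha> + of_nat k)) / (d * (-2 * m))"
    unfolding a_coef_def pochhammer_Suc d_def r_def m_def power_Suc fact_Suc
    by (rule arg_cong2[of _ _ _ _ "(/)"]) (simp_all only: mult_ac)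
  moreover have "(1/2 + \<alpha> + of_nat k) * (1/2 - \<alpha> + of_nat k) = (of_nat k + 1/2)\<^sup>2 - \<alpha>\<^sup>2"
    by (simp add: power2_eq_square algebra_simps)
  moreover have "a_coef \<alpha> k = r / d"
    by (simp add: a_coef_def r_def d_def)
  moreover have "2 * m * (r * (s - t) / (d * (-2 * m))) = (t - s) * (r / d)" for s t
    using \<open>m \<noteq> 0\<close> \<open>d \<noteq> 0\<close> by (simp add: field_simps)
  ultimately show ?thesis
    unfolding m_def[symmetric] by (simp only:)
qed

text \<open>
  The modified Bessel equation \<open>\<theta>\<^sup>2 y = (s\<^sup>2/w\<^sup>2 + \<alpha>\<^sup>2) y\<close>. The coefficients of \<open>s\<^sup>2\<close> cancel
  identically, and what remains in each degree is the two-term recurrence of the \<open>a\<^sub>k\<close>.\<close>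

lemma bessel_series_ode:
  fixes \<alpha> w :: complex
  assumes "w \<noteq> 0"
  defines "y \<equiv> fps_to_fls (bessel_series \<alpha> w)"
  shows "twisted_euler (1/2) (1/w) (twisted_euler (1/2) (1/w) y) =
           (fls_const (1 / w\<^sup>2) * fls_X_inv\<^sup>2 + fls_const (\<alpha>\<^sup>2)) * y"
proof (rule fls_eqI)
  fix n :: int
  \<comment> \<open>At \<open>n = -1\<close> the recurrence holds because of the factor \<open>n + 1\<close>.\<close>
  have rec: "((of_int n + 1/2)\<^sup>2 - \<alpha>\<^sup>2) * fls_nth y n
               + 2 * (of_int n + 1) / w * fls_nth y (n + 1) = 0"
  proof (cases "n \<ge> 0")
    case True
    then obtain k where n: "n = int k" using nonneg_int_cases by blast
    have "int k + 1 = int (Suc k)" by simp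
    then have "fls_nth y (n + 1) = a_coef \<alpha> (Suc k) * w ^ Suc k"
      unfolding n y_def by (simp only: fps_to_fls_nth nat_int of_nat_less_0_iff if_False bessel_series_def fps_nth_Abs_fps)
    then have "2 * (of_int n + 1) / w * fls_nth y (n + 1)
                 = (2 * of_nat (Suc k) * a_coef \<alpha> (Suc k)) * w ^ k"
      using assms(1) by (simp add: n field_simps)
    then show ?thesis
      unfolding a_coef_Suc by (simp add: n y_def bessel_series_def algebra_simps)
  next
    case False
    then have "n = -1 \<or> n + 1 < 0" by auto
    with False show ?thesis by (auto simp: y_def)
  qed
  have balance: "u - v + t = 0 \<Longrightarrow> u + t + s = s + v" for s t u v :: complex
    by algebra
  have "fls_nth (twisted_euler (1/2) (1/w) (twisted_euler (1/2) (1/w) y)) n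
          = (of_int n + 1/2)\<^sup>2 * fls_nth y n + 2 * (of_int n + 1) / w * fls_nth y (n + 1)
            + 1 / w\<^sup>2 * fls_nth y (n + 2)"
    unfolding twisted_euler_nth divide_inverse power2_eq_square inverse_mult_distrib
    by (simp add: algebra_simps)
  also have "\<dots> = 1 / w\<^sup>2 * fls_nth y (n + 2) + \<alpha>\<^sup>2 * fls_nth y n"
    using rec unfolding left_diff_distrib by (rule balance)
  also have "\<dots> = fls_nth ((fls_const (1 / w\<^sup>2) * fls_X_inv\<^sup>2 + fls_const (\<alpha>\<^sup>2)) * y) n"
    unfolding ring_distribs(2) mult.assoc fls_X_inv_power_times_conv_shift(1) by simp
  finally show "fls_nth (twisted_euler (1/2) (1/w) (twisted_euler (1/2) (1/w) y)) n =
      fls_nth ((fls_const (1 / w\<^sup>2) * fls_X_inv\<^sup>2 + fls_const (\<alpha>\<^sup>2)) * y) n" .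
qed

lemma bessel_product_eq_G_diag:
  "bessel_series \<alpha> p_const * bessel_series \<alpha> q_const = Abs_fps (G_diag \<alpha>)"
  by (rule fps_ext) (simp add: fps_mult_nth bessel_series_def G_diag_def mult_ac)

text \<open>
  The values \<open>p\<^sup>2 = 2 \<i>\<close> and \<open>q\<^sup>2 = - 2 \<i>\<close> give \<open>c = 1/p\<^sup>2 = - 1/q\<^sup>2\<close> and \<open>- 4 c\<^sup>2 = 1\<close>.\<close>

lemma G_diag_ode:
  fixes \<alpha> :: complex
  defines "D \<equiv> twisted_euler 1 1" and "g \<equiv> fps_to_fls (Abs_fps (G_diag \<alpha>))"
  defines "Q \<equiv> D (D g) - fls_const (4 * \<alpha>\<^sup>2) * g"
  shows "D (D Q) - fls_const 2 * D Q = fls_X_inv ^ 4 * g"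
proof -
  let ?c = "1 / p_const\<^sup>2" 
  have ne: "p_const \<noteq> 0" "q_const \<noteq> 0"
    by (auto simp: p_const_def q_const_def complex_eq_iff)
  have c: "1 / q_const\<^sup>2 = - ?c" "- (4 * ?c\<^sup>2) = 1"  "1 / p_const + 1 / q_const = 1"
  proof -
    have sq: "p_const\<^sup>2 = 2 * \<i>" "q_const\<^sup>2 = - 2 * \<i>"
      by (simp_all add: p_const_def q_const_def power2_eq_square algebra_simps)
    then show "1 / q_const\<^sup>2 = - ?c" "- (4 * ?c\<^sup>2) = 1"
      by (simp_all add: power_divide power_mult_distrib)
    have "p_const * q_const = 2" "p_const + q_const = 2"
      by (simp_all add: p_const_def q_const_def algebra_simps)
    then show "1 / p_const + 1 / q_const = 1"
      using ne by (simp add: add_frac_eq add.commute)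
  qed
  have g: "g = fps_to_fls (bessel_series \<alpha> p_const) * fps_to_fls (bessel_series \<alpha> q_const)"
    by (simp add: g_def flip: bessel_product_eq_G_diag fls_times_fps_to_fls)
  note ode = product_ode[OF bessel_series_ode[OF ne(1), of \<alpha>]
      bessel_series_ode[OF ne(2), of \<alpha>, unfolded c fls_const_uminus]]
  have "- fls_const (4 * ?c\<^sup>2) = 1"
    using c(2) by (metis fls_const_uminus fls_const_1)
  with ode show ?thesis
    unfolding c by (simp add: g[symmetric] D_def Q_def)
qed

section \<open>Superpositions of graded families of power series\<close>

text \<open>
  The infinite sum \<open>\<Sum>n. g n \<cdot> e n\<close>, with its coefficients written as finite sums. It is the
  \<open>X\<close>-adic limit of the partial sums when \<open>e n\<close> is divisible by \<open>X\<^sup>n\<close>, which is what \<open>graded\<close> says.\<close>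

definition superpose :: "(nat \<Rightarrow> 'a::comm_ring_1 fps) \<Rightarrow> (nat \<Rightarrow> 'a) \<Rightarrow> 'a fps" where
  "superpose e g = Abs_fps (\<lambda>m. \<Sum>n\<le>m. g n * fps_nth (e n) m)"

definition graded :: "(nat \<Rightarrow> 'a::comm_ring_1 fps) \<Rightarrow> bool" where
  "graded e \<longleftrightarrow> (\<forall>n m. m < n \<longrightarrow> fps_nth (e n) m = 0)"

lemma superpose_nth_extend:
  assumes "graded e" "m \<le> N"
  shows "fps_nth (superpose e g) m = (\<Sum>n\<le>N. g n * fps_nth (e n) m)"
  unfolding superpose_def fps_nth_Abs_fps using assms
  by (intro sum.mono_neutral_left) (auto simp: graded_def)

lemma superpose_mult:
  assumes "graded e"
  shows "w * superpose e g = superpose (\<lambda>n. w * e n) g"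
proof (rule fps_ext)
  fix m
  have "fps_nth (w * superpose e g) m
          = (\<Sum>i\<le>m. fps_nth w i * (\<Sum>n\<le>m. g n * fps_nth (e n) (m - i)))"
    unfolding fps_mult_nth atLeast0AtMost
    by (intro sum.cong refl arg_cong2[of _ _ _ _ "(*)"] superpose_nth_extend assms) auto
  also have "\<dots> = (\<Sum>n\<le>m. g n * fps_nth (w * e n) m)"
    unfolding fps_mult_nth atLeast0AtMost sum_distrib_left
    by (subst sum.swap) (simp add: mult_ac)
  finally show "fps_nth (w * superpose e g) m = fps_nth (superpose (\<lambda>n. w * e n) g) m"
    by (simp add: superpose_def)
qed

lemma superpose_compose:
  fixes e :: "nat \<Rightarrow> 'a::idom fps"
  assumes "graded e" "fps_nth c 0 = 0"
  shows "superpose e g oo c = superpose (\<lambda>n. e n oo c) g"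
proof (rule fps_ext)
  fix m
  have "fps_nth (superpose e g oo c) m
          = (\<Sum>i\<le>m. (\<Sum>n\<le>m. g n * fps_nth (e n) i) * fps_nth (c ^ i) m)"
    unfolding fps_compose_nth atLeast0AtMost
    by (intro sum.cong refl arg_cong2[of _ _ _ _ "(*)"] superpose_nth_extend assms) auto
  also have "\<dots> = (\<Sum>n\<le>m. g n * fps_nth (e n oo c) m)"
    unfolding fps_compose_nth atLeast0AtMost sum_distrib_left sum_distrib_right
    by (subst sum.swap) (simp add: mult_ac)
  finally show "fps_nth (superpose e g oo c) m = fps_nth (superpose (\<lambda>n. e n oo c) g) m"
    by (simp add: superpose_def)
qed

lemma graded_mult: "graded e \<Longrightarrow> graded (\<lambda>n. w * e n)"
  by (auto simp: graded_def fps_mult_nth intro!: sum.neutral)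

lemma superpose_drop:
  assumes "graded e" "\<And>n. n < k \<Longrightarrow> g n = 0"
  shows "superpose e g = superpose (\<lambda>n. e (n + k)) (\<lambda>n. g (n + k))"
proof (rule fps_ext)
  fix m
  have "fps_nth (superpose e g) m = (\<Sum>n\<le>m + k. g n * fps_nth (e n) m)"
    by (rule superpose_nth_extend) (use assms in auto)
  also have "\<dots> = (\<Sum>n\<in>{k..m + k}. g n * fps_nth (e n) m)"
    by (rule sum.mono_neutral_right) (use assms in \<open>auto simp: not_le\<close>)
  also have "\<dots> = (\<Sum>n\<le>m. g (n + k) * fps_nth (e (n + k)) m)"
    by (rule sum.reindex_bij_witness[of _ "\<lambda>n. n + k" "\<lambda>n. n - k"]) auto
  finally show "fps_nth (superpose e g) m =
      fps_nth (superpose (\<lambda>n. e (n + k)) (\<lambda>n. g (n + k))) m"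
    by (simp add: superpose_def)
qed

section \<open>The formal Mellin transform\<close>

text \<open>
  With \<open>X = 1/Z\<close>, the \<open>n\<close>-th element is \<open>Z\<^sup>-\<^sup>4 \<Gamma>(Z + 4 - n) / \<Gamma>(Z)\<close>, the normalised Mellin transform
  of \<open>s\<^sup>4\<^sup>-\<^sup>n\<close>. The factor \<open>Z\<^sup>-\<^sup>4\<close> makes these power series although the powers of \<open>s\<close> up to the
  fourth, which a differential operator of order four produces, are included.\<close>

primrec shifted_inv_fact :: "nat \<Rightarrow> complex fps" where
  "shifted_inv_fact 0 = (1 + fps_X) * (1 + 2 * fps_X) * (1 + 3 * fps_X)"
| "shifted_inv_fact (Suc n) =
     fps_X * inverse (1 - fps_const (of_nat n - 3) * fps_X) * shifted_inv_fact n"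

lemma X_mult_shifted_inv_fact:
  "fps_X * shifted_inv_fact n = (1 - fps_const (of_nat n - 3) * fps_X) * shifted_inv_fact (Suc n)"
proof -
  have "(1 - fps_const (of_nat n - 3) * fps_X) * inverse (1 - fps_const (of_nat n - 3 :: complex) * fps_X) = 1"
    by (rule inverse_mult_eq_1') simp
  then show ?thesis by (simp add: mult_ac)
qed

lemma graded_shifted_inv_fact: "graded shifted_inv_fact"
proof -
  have "\<exists>r. shifted_inv_fact n = fps_X ^ n * r" for n
  proof (induction n)
    case (Suc n)
    then obtain r where "shifted_inv_fact n = fps_X ^ n * r" by blast
    then have "shifted_inv_fact (Suc n)
        = fps_X ^ Suc n * (inverse (1 - fps_const (of_nat n - 3) * fps_X) * r)"
      by (simp add: mult_ac)
    then show ?case by blast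
  qed auto
  then show ?thesis
    unfolding graded_def by (metis fps_X_power_mult_nth)
qed

text \<open>
  For a Laurent series \<open>f\<close> in \<open>1/s\<close> this is the power series \<open>Z\<^sup>-\<^sup>4 \<integral> s\<^sup>Z\<^sup>-\<^sup>1 e\<^sup>-\<^sup>s f ds / \<Gamma>(Z)\<close> in
  \<open>1/Z\<close>, integrated termwise. Powers of \<open>s\<close> beyond the fourth are discarded.\<close>

definition mellin :: "complex fls \<Rightarrow> complex fps" where
  "mellin f = superpose shifted_inv_fact (\<lambda>n. fls_nth f (int n - 4))"

lemma mellin_diff: "mellin (f - g) = mellin f - mellin g"
  and mellin_const_mult: "mellin (fls_const c * f) = fps_const c * mellin f"
  by (auto simp: mellin_def superpose_def fps_eq_iff algebra_simps sum_subtractf sum_distrib_left)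

text \<open>
  Integration by parts: \<open>\<theta>\<close> acts on \<open>s\<^sup>-\<^sup>1 e\<^sup>-\<^sup>s f\<close>, and \<open>\<integral> s\<^sup>Z \<theta>(\<dots>) ds = -(Z + 1) \<integral> s\<^sup>Z (\<dots>) ds\<close>. On
  coefficients it is a summation by parts based on \<open>Z\<^sup>-\<^sup>1 E\<^sub>n = (1 - (n - 3) Z\<^sup>-\<^sup>1) E\<^sub>n\<^sub>+\<^sub>1\<close>, where \<open>E\<^sub>n\<close> is
  the basis of inverse factorials. The assumption on \<open>f\<close> removes the boundary
  term: \<open>\<theta>\<close> would turn \<open>s\<^sup>4\<close> into a multiple of \<open>s\<^sup>5\<close>, which is cut off, plus lower terms.\<close>

lemma X_mult_mellin_twisted_euler:
  assumes "fls_nth f (-4) = 0"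
  shows "fps_X * mellin (twisted_euler 1 1 f) = - (1 + fps_X) * mellin f"
proof (rule fps_ext)
  fix m
  define h where "h n = fls_nth f (int n - 4)" for n
  let ?H = shifted_inv_fact
  have h0: "h 0 = 0" using assms by (simp add: h_def)
  have D: "fls_nth (twisted_euler 1 1 f) (int n - 4) = (3 - of_nat n) * h n - h (Suc n)" for n
  proof -
    have "int n - 4 + 1 = int (Suc n) - 4" by simp
    then show ?thesis by (simp only: twisted_euler_nth h_def) simp
  qed
  have "fps_X * mellin (twisted_euler 1 1 f)
          = superpose (\<lambda>n. fps_X * ?H n) (\<lambda>n. (3 - of_nat n) * h n - h (Suc n))"
    unfolding mellin_def D by (rule superpose_mult[OF graded_shifted_inv_fact])
  then have "fps_nth (fps_X * mellin (twisted_euler 1 1 f)) m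
          = (\<Sum>n\<le>m. ((3 - of_nat n) * h n - h (Suc n)) * fps_nth (fps_X * ?H n) m)"
    by (simp only: superpose_def fps_nth_Abs_fps)
  also have "\<dots> = (\<Sum>n\<le>m. (3 - of_nat n) * h n * fps_nth (fps_X * ?H n) m)
            - (\<Sum>n\<le>m. h (Suc n) * fps_nth (fps_X * ?H n) m)"
    by (simp only: left_diff_distrib sum_subtractf)
  also have "(\<Sum>n\<le>m. h (Suc n) * fps_nth (fps_X * ?H n) m)
       = (\<Sum>n\<le>m. h (Suc n) * fps_nth ((1 - fps_const (of_nat (Suc n) - 4) * fps_X) * ?H (Suc n)) m)"
    unfolding X_mult_shifted_inv_fact by (simp del: shifted_inv_fact.simps)
  also have "\<dots> = (\<Sum>n\<le>Suc m. h n * fps_nth ((1 - fps_const (of_nat n - 4) * fps_X) * ?H n) m)"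
    unfolding sum.atMost_Suc_shift by (simp add: h0 del: shifted_inv_fact.simps)
  \<comment> \<open>The summand for \<open>n = m + 1\<close> vanishes because the basis is graded.\<close>
  also have "\<dots> = (\<Sum>n\<le>m. h n * fps_nth ((1 - fps_const (of_nat n - 4) * fps_X) * ?H n) m)"
  proof -
    have "fps_nth ((1 - fps_const (of_nat (Suc m) - 4) * fps_X) * ?H (Suc m)) m = 0"
      using graded_mult[OF graded_shifted_inv_fact, of "1 - fps_const (of_nat (Suc m) - 4) * fps_X"]
      unfolding graded_def by blast
    then show ?thesis by (simp del: shifted_inv_fact.simps)
  qed
  finally have "fps_nth (fps_X * mellin (twisted_euler 1 1 f)) m
      = (\<Sum>n\<le>m. (3 - of_nat n) * h n * fps_nth (fps_X * ?H n) m
            - h n * fps_nth ((1 - fps_const (of_nat n - 4) * fps_X) * ?H n) m)"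
    unfolding sum_subtractf .
  also have "\<dots> = (\<Sum>n\<le>m. h n * fps_nth (- (1 + fps_X) * ?H n) m)"
  proof (rule sum.cong[OF refl])
    fix n
    have split: "- (1 + fps_X) * ?H n = fps_const (3 - of_nat n) * (fps_X * ?H n)
            - (1 - fps_const (of_nat n - 4) * fps_X) * ?H n"
      by (simp add: algebra_simps numeral_fps_const[symmetric] flip: fps_const_sub)
    have collect: "c * a * x - a * y = a * (c * x - y)" for a c x y :: complex
      by (simp add: algebra_simps)
    show "(3 - of_nat n) * h n * fps_nth (fps_X * ?H n) m
            - h n * fps_nth ((1 - fps_const (of_nat n - 4) * fps_X) * ?H n) m
          = h n * fps_nth (- (1 + fps_X) * ?H n) m"
      unfolding split fps_sub_nth fps_mult_left_const_nth by (rule collect)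
  qed
  also have "\<dots> = fps_nth (- (1 + fps_X) * mellin f) m"
    unfolding mellin_def superpose_mult[OF graded_shifted_inv_fact] by (simp add: superpose_def h_def)
  finally show "fps_nth (fps_X * mellin (twisted_euler 1 1 f)) m = fps_nth (- (1 + fps_X) * mellin f) m" .
qed

definition inv_fact_series :: "nat \<Rightarrow> complex fps" where
  "inv_fact_series n = (\<Prod>j=1..n. fps_X / (1 - of_nat j * fps_X))"

lemma inv_fact_series_Suc:
  "inv_fact_series (Suc n) =
     fps_X * inverse (1 - fps_const (of_nat (Suc n)) * fps_X) * inv_fact_series n"
proof -
  have "fps_X / (1 - of_nat (Suc n) * fps_X :: complex fps)
          = fps_X * inverse (1 - fps_const (of_nat (Suc n)) * fps_X)"
    unfolding fps_of_nat[symmetric] by (rule fps_divide_unit) simp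
  then show ?thesis by (simp add: inv_fact_series_def mult_ac)
qed

lemma graded_inv_fact_series: "graded inv_fact_series"
  using F_diag_term_altdef
  unfolding graded_def inv_fact_series_def 
  by (auto simp: fps_divide_unit prod.distrib fps_X_power_mult_nth)

lemma F_diag_superpose: "F_diag \<alpha> = superpose inv_fact_series (G_diag \<alpha>)"
  by (rule fps_ext) (simp add: F_diag_nth F_diag_term_def superpose_def inv_fact_series_def)

lemma shifted_inv_fact_add_4: "shifted_inv_fact (n + 4) = fps_X ^ 4 * inv_fact_series n"
proof (induction n)
  case 0
  have inv: "inverse (1 + k * fps_X) * (1 + k * fps_X) = 1" for k :: "complex fps"
    by (rule inverse_mult_eq_1) simp
  have "shifted_inv_fact 4 = fps_X ^ 4 * ((inverse (1 + 1 * fps_X) * (1 + 1 * fps_X))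
     * (inverse (1 + 2 * fps_X) * (1 + 2 * fps_X)) * (inverse (1 + 3 * fps_X) * (1 + 3 * fps_X)))"
    by (simp add: eval_nat_numeral mult_ac numeral_fps_const flip: fps_const_neg)
  then show ?case unfolding inv by (simp add: inv_fact_series_def)
next
  case (Suc n)
  have "Suc n + 4 = Suc (n + 4)" "(of_nat (n + 4) - 3 :: complex) = of_nat (Suc n)" by simp_all
  then show ?case
    by (simp only: shifted_inv_fact.simps Suc inv_fact_series_Suc) (simp only: mult_ac)
qed

text \<open>
  The substitution \<open>Z \<mapsto> Z + 4\<close> in terms of \<open>X = 1/Z\<close>.\<close>

definition shift4 :: "complex fps" where
  "shift4 = fps_X * inverse (1 + fps_const 4 * fps_X)"

text \<open>
  The shift \<open>Z \<mapsto> Z + 4\<close> sends \<open>1 / ((Z - 1) \<cdots> (Z - n))\<close> to \<open>\<Gamma>(Z + 4 - n) / \<Gamma>(Z + 4)\<close>, and the factor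
  \<open>(1 + X) (1 + 2X) (1 + 3X) = Z\<^sup>-\<^sup>4 \<Gamma>(Z + 4) / \<Gamma>(Z)\<close> does not depend on \<open>n\<close>. Hence multiplication by
  \<open>s\<^sup>4\<close> before the Mellin transform is this shift after it.\<close>

lemma shifted_inv_fact_eq_compose:
  "shifted_inv_fact n = shifted_inv_fact 0 * (inv_fact_series n oo shift4)"
proof (induction n)
  case 0
  then show ?case by (simp add: inv_fact_series_def)
next
  case (Suc n)
  define u :: "complex fps" where "u = 1 + fps_const 4 * fps_X"
  define k :: complex where "k = of_nat n - 3"
  define v where "v = 1 - fps_const (of_nat (Suc n)) * shift4"
  have s0: "fps_nth shift4 0 = 0" by (simp add: shift4_def)
  have u: "inverse u * u = 1" "u \<noteq> 0"
    by (auto simp: u_def intro!: inverse_mult_eq_1 dest: arg_cong[of _ _ "\<lambda>f. fps_nth f 0"])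
  have iv: "inverse v * v = 1"
    by (intro inverse_mult_eq_1) (simp add: v_def s0)
  have s: "u * shift4 = fps_X"
    using u(1) unfolding shift4_def u_def[symmetric] by (simp add: mult_ac)
  have "u * v = 1 - fps_const k * fps_X"
    unfolding v_def right_diff_distrib mult.left_commute[of u] s
    by (simp add: u_def k_def algebra_simps flip: fps_const_add fps_const_sub)
  have "shift4 * inverse v * (u * v) = fps_X"
    using iv s by (metis mult.assoc mult.commute mult_1)
  moreover have "fps_X * inverse (1 - fps_const k * fps_X) * (1 - fps_const k * fps_X) = fps_X"
    unfolding mult.assoc by (subst inverse_mult_eq_1) auto
  moreover have "(1 - fps_const k * fps_X) \<noteq> 0" 
    by (auto dest: arg_cong[of _ _ "\<lambda>f. fps_nth f 0"])
  ultimately have step: "shift4 * inverse v = fps_X * inverse (1 - fps_const k * fps_X)"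
    unfolding \<open>u * v = _\<close> by (metis mult_right_cancel)
  have "inv_fact_series (Suc n) oo shift4
         = shift4 * inverse v * (inv_fact_series n oo shift4)"
    unfolding inv_fact_series_Suc
    by (simp add: fps_compose_mult_distrib s0 fps_inverse_compose fps_compose_sub_distrib v_def
          del: of_nat_Suc)
  then show ?case
    unfolding step by (simp add: Suc k_def mult_ac)
qed

lemma mellin_G_diag:
  "mellin (fps_to_fls (Abs_fps (G_diag \<alpha>))) = fps_X ^ 4 * F_diag \<alpha>"
  unfolding F_diag_superpose superpose_mult[OF graded_inv_fact_series] mellin_def
  by (subst superpose_drop[where k = 4])
     (simp_all add: graded_shifted_inv_fact shifted_inv_fact_add_4 del: shifted_inv_fact.simps)

lemma mellin_X_inv4_G_diag:
  "mellin (fls_X_inv ^ 4 * fps_to_fls (Abs_fps (G_diag \<alpha>)))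
     = shifted_inv_fact 0 * (F_diag \<alpha> oo shift4)"
proof -
  have s0: "fps_nth shift4 0 = 0" by (simp add: shift4_def)
  have gr: "graded (\<lambda>n. inv_fact_series n oo shift4)"
    using graded_inv_fact_series startsby_zero_power_prefix[OF s0]
    by (force simp: graded_def fps_compose_nth intro!: sum.neutral)
  have "mellin (fls_X_inv ^ 4 * fps_to_fls (Abs_fps (G_diag \<alpha>)))
          = superpose shifted_inv_fact (G_diag \<alpha>)"
    by (simp add: mellin_def fls_X_inv_power_times_conv_shift)
  also have "\<dots> = superpose (\<lambda>n. shifted_inv_fact 0 * (inv_fact_series n oo shift4)) (G_diag \<alpha>)"
    by (simp only: shifted_inv_fact_eq_compose[symmetric] eta_contract_eq)
  also have "\<dots> = shifted_inv_fact 0 * (F_diag \<alpha> oo shift4)"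
    unfolding F_diag_superpose superpose_compose[OF graded_inv_fact_series s0]
      superpose_mult[OF gr] ..
  finally show ?thesis .
qed

section \<open>The difference equation\<close>

text \<open>
  The Mellin transform of \<open>G_diag_ode\<close>, in the variable \<open>X = 1/Z\<close>: the operators \<open>\<theta>\<^sup>2 - 4\<alpha>\<^sup>2\<close>, \<open>\<theta>\<close>
  and \<open>\<theta> - 2\<close> contribute, up to sign, \<open>(1 + X)\<^sup>2 - 4\<alpha>\<^sup>2 X\<^sup>2\<close>, \<open>1 + X\<close> and \<open>1 + 3X\<close>, of which the last two
  cancel against \<open>(1 + X) (1 + 2X) (1 + 3X)\<close>.\<close>

lemma F_diag_functional_equation:
  "(1 + fps_const 2 * fps_X) * (F_diag \<alpha> oo shift4) =
     (1 + fps_const (1 + 2 * \<alpha>) * fps_X) * (1 + fps_const (1 - 2 * \<alpha>) * fps_X) * F_diag \<alpha>"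
proof -
  define g where "g = fps_to_fls (Abs_fps (G_diag \<alpha>))"
  define D where "D = twisted_euler 1 1"
  define Q where "Q = D (D g) - fls_const (4 * \<alpha>\<^sup>2) * g"
  have euler: "fps_X * mellin (D f) = - (1 + fps_X) * mellin f" if "fls_nth f (-4) = 0" for f
    unfolding D_def by (rule X_mult_mellin_twisted_euler[OF that])
  have ode: "D (D Q) - fls_const 2 * D Q = fls_X_inv ^ 4 * g"
    unfolding D_def Q_def g_def by (rule G_diag_ode)
  have mellin_g: "mellin g = fps_X ^ 4 * F_diag \<alpha>"
    "mellin (fls_X_inv ^ 4 * g) = shifted_inv_fact 0 * (F_diag \<alpha> oo shift4)"
    unfolding g_def by (rule mellin_G_diag mellin_X_inv4_G_diag)+
  have lead: "fls_nth g k = 0" if "k < 0" for k using that by (simp add: g_def)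
  have "fps_X\<^sup>2 * mellin Q = fps_X * (fps_X * mellin (D (D g)))
          - fps_const (4 * \<alpha>\<^sup>2) * fps_X\<^sup>2 * mellin g"
    unfolding Q_def mellin_diff mellin_const_mult
    by (simp add: algebra_simps power2_eq_square)
  also have "fps_X * mellin (D (D g)) = - (1 + fps_X) * mellin (D g)"
    by (rule euler) (simp add: D_def lead)
  also have "fps_X * (- (1 + fps_X) * mellin (D g)) = - (1 + fps_X) * (fps_X * mellin (D g))"
    by (simp only: mult_ac)
  also have "fps_X * mellin (D g) = - (1 + fps_X) * mellin g"
    by (rule euler) (simp add: lead)
  finally have Q: "fps_X\<^sup>2 * mellin Q
      = ((1 + fps_X)\<^sup>2 - fps_const (4 * \<alpha>\<^sup>2) * fps_X\<^sup>2) * mellin g"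
    by (simp add: algebra_simps power2_eq_square)
  have DQ: "fps_X * mellin (D Q) = - (1 + fps_X) * mellin Q"
    by (rule euler) (simp add: D_def Q_def lead)
  have "fps_X\<^sup>2 * mellin (D (D Q) - fls_const 2 * D Q)
      = fps_X * (fps_X * mellin (D (D Q))) - fps_const 2 * fps_X * (fps_X * mellin (D Q))"
    unfolding mellin_diff mellin_const_mult by (simp add: algebra_simps power2_eq_square)
  also have "fps_X * mellin (D (D Q)) = - (1 + fps_X) * mellin (D Q)"
    by (rule euler) (simp add: D_def Q_def lead)
  also have "fps_X * (- (1 + fps_X) * mellin (D Q))
        - fps_const 2 * fps_X * (fps_X * mellin (D Q))
      = - (1 + fps_const 3 * fps_X) * (fps_X * mellin (D Q))"
    by (simp add: algebra_simps numeral_fps_const[symmetric])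
  finally have "fps_X\<^sup>2 * mellin (D (D Q) - fls_const 2 * D Q)
      = - (1 + fps_const 3 * fps_X) * (fps_X * mellin (D Q))" .
  then have "fps_X ^ 4 * mellin (D (D Q) - fls_const 2 * D Q)
      = (1 + fps_const 3 * fps_X) * (1 + fps_X) * (fps_X\<^sup>2 * mellin Q)"
    unfolding DQ by (simp add: power2_eq_square power4_eq_xxxx algebra_simps)
  then have "fps_X ^ 4 * (shifted_inv_fact 0 * (F_diag \<alpha> oo shift4)) =
     (1 + fps_const 3 * fps_X) * (1 + fps_X) *
       (((1 + fps_X)\<^sup>2 - fps_const (4 * \<alpha>\<^sup>2) * fps_X\<^sup>2) * (fps_X ^ 4 * F_diag \<alpha>))"
    unfolding Q ode mellin_g .
  also have "(1 + fps_X)\<^sup>2 - fps_const (4 * \<alpha>\<^sup>2) * fps_X\<^sup>2 =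
      (1 + fps_const (1 + 2 * \<alpha>) * fps_X) * (1 + fps_const (1 - 2 * \<alpha>) * fps_X)"
    by (simp add: algebra_simps power2_eq_square flip: fps_const_add fps_const_sub fps_const_mult)
  finally have "(fps_X ^ 4 * (1 + fps_const 3 * fps_X) * (1 + fps_X)) *
      ((1 + fps_const 2 * fps_X) * (F_diag \<alpha> oo shift4)) =
     (fps_X ^ 4 * (1 + fps_const 3 * fps_X) * (1 + fps_X)) *
       ((1 + fps_const (1 + 2 * \<alpha>) * fps_X) * (1 + fps_const (1 - 2 * \<alpha>) * fps_X) * F_diag \<alpha>)"
    by (simp add: mult_ac numeral_fps_const)
  moreover have "fps_X ^ 4 * (1 + fps_const 3 * fps_X) * (1 + fps_X) \<noteq> (0 :: complex fps)"
    by (auto dest: arg_cong[of _ _ "\<lambda>f. fps_nth f 0"])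
  ultimately show ?thesis by simp
qed

section \<open>Logarithms of power series\<close>

definition fps_log :: "complex fps \<Rightarrow> complex fps" where
  "fps_log f = fps_ln 1 oo (f - 1)"

lemma fps_log_nth_0 [simp]: "fps_nth (fps_log f) 0 = 0"
  by (simp add: fps_log_def)

lemma fps_log_deriv:
  assumes "fps_nth f 0 = 1"
  shows "fps_deriv (fps_log f) = fps_deriv f * inverse f"
proof -
  have "fps_deriv (fps_log f) = (inverse (1 + fps_X) oo (f - 1)) * fps_deriv f"
    unfolding fps_log_def using assms by (subst fps_compose_deriv) (simp_all add: fps_ln_deriv)
  also have "inverse (1 + fps_X) oo (f - 1) = inverse f"
    using assms by (subst fps_inverse_compose) (simp_all add: fps_compose_add_distrib)
  finally show ?thesis by (simp add: mult.commute)
qed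

text \<open>
  Both sides have the same logarithmic derivative and constant term \<open>0\<close>.\<close>

lemma fps_log_mult:
  assumes "fps_nth f 0 = 1" "fps_nth g 0 = 1"
  shows "fps_log (f * g) = fps_log f + fps_log g"
proof -
  have inv: "inverse f * f = 1" "inverse g * g = 1"
    using assms by (auto intro: inverse_mult_eq_1)
  have "fps_deriv (fps_log (f * g))
          = fps_deriv f * inverse f * (inverse g * g) + fps_deriv g * inverse g * (inverse f * f)"
    using assms by (simp add: fps_log_deriv fps_inverse_mult algebra_simps)
  also have "\<dots> = fps_deriv (fps_log f + fps_log g)"
    unfolding inv using assms by (simp add: fps_log_deriv)
  finally show ?thesis
    unfolding fps_deriv_eq_iff by simp
qed

lemma fps_log_compose:
  assumes "fps_nth c 0 = 0"  "fps_nth f 0 = 1"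
  shows "fps_log (f oo c) = fps_log f oo c"
proof -
  have "(f oo c) - 1 = (f - 1) oo c"
    by (simp add: fps_compose_sub_distrib)
  then show ?thesis
    unfolding fps_log_def using assms by (simp add: fps_compose_assoc)
qed

lemma fps_log_linear_nth:
  "fps_nth (fps_log (1 + fps_const a * fps_X)) n
     = (if n = 0 then 0 else - ((- a) ^ n / of_nat n))"
proof (cases n)
  case (Suc k)
  have "fps_nth (fps_ln 1 oo (fps_const a * fps_X)) n = a ^ n * fps_nth (fps_ln 1) n"
    by (simp add: fps_compose_linear)
  then show ?thesis
    by (simp add: fps_log_def fps_ln_nth Suc power_minus[of a])
qed simp

section \<open>The Borel transform\<close>

text \<open>
  The transform \<open>X\<^sup>n \<mapsto> t\<^sup>n / (n - 1)!\<close> for \<open>n \<ge> 1\<close>, and \<open>1 \<mapsto> 0\<close>: the quotient \<open>n / n!\<close> covers both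
  cases.\<close>

definition borel :: "complex fps \<Rightarrow> complex fps" where
  "borel f = Abs_fps (\<lambda>n. of_nat n / fact n * fps_nth f n)"

lemma borel_add: "borel (f + g) = borel f + borel g"
  by (simp add: borel_def fps_eq_iff algebra_simps)

lemma borel_fps_log_linear: "borel (fps_log (1 + fps_const a * fps_X)) = 1 - fps_exp (- a)"
  by (rule fps_ext) (simp add: borel_def fps_log_linear_nth)

lemma shift4_power_nth:
  assumes "k > 0"
  shows "fps_nth (shift4 ^ k) n = (if n < k then 0 else of_nat ((n - 1) choose (k - 1)) * (-4) ^ (n - k))"
proof -
  have "shift4 ^ k = fps_X ^ k * inverse ((1 - fps_const (-4) * fps_X) ^ k)"
    by (simp add: shift4_def power_mult_distrib fps_inverse_power flip: fps_const_neg)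
  then have "fps_nth (shift4 ^ k) n
      = (if n < k then 0 else of_nat ((k + (n - k) - 1) choose (n - k)) * (-4) ^ (n - k))"
    unfolding one_minus_const_fps_X_neg_power'[OF assms] by (simp add: fps_X_power_mult_nth)
  moreover have "(k + (n - k) - 1) choose (n - k) = (n - 1) choose (k - 1)" if "\<not> n < k"
    using that assms binomial_symmetric[of "k - 1" "n - 1"] by auto
  ultimately show ?thesis by simp
qed

text \<open>
  The Borel form of \<open>Z \<mapsto> Z + 4\<close>: if \<open>f(Z)\<close> has Borel transform \<open>\<phi>(t)\<close>, it is the Laplace transform of
  \<open>\<phi>(t) / t\<close> up to its constant term, so shifting \<open>Z\<close> by \<open>4\<close> multiplies \<open>\<phi>\<close> by \<open>e\<^sup>-\<^sup>4\<^sup>t\<close>. On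
  coefficients, the factorials turn the negative binomial expansion of \<open>(Z + 4)\<^sup>-\<^sup>k\<close> into the exponential series.\<close>

lemma borel_shift4: "borel (f oo shift4) = borel f * fps_exp (-4)"
proof (rule fps_ext)
  fix n
  have "fps_nth (borel (f oo shift4)) n
      = (\<Sum>k=0..n. of_nat n / fact n * (fps_nth f k * fps_nth (shift4 ^ k) n))"
    by (simp add: borel_def fps_compose_nth sum_distrib_left)
  also have "\<dots> = (\<Sum>k=0..n. of_nat k / fact k * fps_nth f k * ((-4) ^ (n - k) / fact (n - k)))"
  proof (rule sum.cong[OF refl])
    fix k assume k: "k \<in> {0..n}"
    show "of_nat n / fact n * (fps_nth f k * fps_nth (shift4 ^ k) n)
        = of_nat k / fact k * fps_nth f k * ((-4) ^ (n - k) / fact (n - k))"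
    proof (cases "k = 0")
      case True
      then show ?thesis by (cases "n = 0") auto
    next
      case False
      with k obtain j m where jm: "k = Suc j" "n = Suc m" "j \<le> m"
        by (metis Suc_le_mono atLeastAtMost_iff not0_implies_Suc le_zero_eq)
      have fct: "of_nat (Suc i) / fact (Suc i) = (1 / fact i :: complex)" for i
        by (simp add: fact_Suc del: of_nat_Suc)
      have "(of_nat (m choose j) :: complex) = fact m / (fact j * fact (m - j))"
        using jm(3) by (rule binomial_fact)
      then show ?thesis
        using jm(3) unfolding jm(1,2) fct by (simp add: shift4_power_nth del: power_Suc)
    qed
  qed
  also have "\<dots> = fps_nth (borel f * fps_exp (-4)) n"
    by (simp add: fps_mult_nth borel_def)
  finally show "fps_nth (borel (f oo shift4)) n = fps_nth (borel f * fps_exp (-4)) n" .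
qed

lemma Psi_at_eq_borel: "Psi_at (\<alpha>\<^sup>2) = borel (log_F_diag \<alpha>)"
proof (rule fps_ext)
  fix n
  show "fps_nth (Psi_at (\<alpha>\<^sup>2)) n = fps_nth (borel (log_F_diag \<alpha>)) n"
    by (cases n) (simp_all add: Psi_at_def Psi_def borel_def poly_L_diag fact_Suc del: of_nat_Suc)
qed

text \<open>
  The Borel transform of the logarithm of \<open>F_diag_functional_equation\<close>. All three conclusions
  about \<open>\<Psi>\<close> are read off from it, since \<open>e\<^sup>-\<^sup>4\<^sup>t - 1\<close> is not a zero divisor.\<close>

lemma Psi_at_functional_equation:
  "Psi_at (\<alpha>\<^sup>2) * (fps_exp (-4) - 1)
     = 1 + fps_exp (-2) - fps_exp (-1) * (fps_exp (2 * \<alpha>) + fps_exp (- (2 * \<alpha>)))"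
proof -
  have s0: "fps_nth shift4 0 = 0" by (simp add: shift4_def)
  have log: "log_F_diag \<alpha> = fps_log (F_diag \<alpha>)"
    by (simp add: log_F_diag_def fps_log_def)
  have "fps_log ((1 + fps_const 2 * fps_X) * (F_diag \<alpha> oo shift4))
     = fps_log ((1 + fps_const (1 + 2 * \<alpha>) * fps_X)
         * (1 + fps_const (1 - 2 * \<alpha>) * fps_X) * F_diag \<alpha>)"
    by (simp only: F_diag_functional_equation)
  then have "fps_log (1 + fps_const 2 * fps_X) + (fps_log (F_diag \<alpha>) oo shift4)
     = fps_log (1 + fps_const (1 + 2 * \<alpha>) * fps_X)
         + fps_log (1 + fps_const (1 - 2 * \<alpha>) * fps_X) + fps_log (F_diag \<alpha>)"
    by (simp add: fps_log_mult F_diag_nth_0 s0 fps_log_compose)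
  then have "1 - fps_exp (-2) + Psi_at (\<alpha>\<^sup>2) * fps_exp (-4)
     = (1 - fps_exp (- (1 + 2 * \<alpha>))) + (1 - fps_exp (- (1 - 2 * \<alpha>))) + Psi_at (\<alpha>\<^sup>2)"
    unfolding Psi_at_eq_borel log
    by (metis borel_add borel_fps_log_linear borel_shift4)
  moreover have "fps_exp (- (1 + 2 * \<alpha>)) = fps_exp (-1) * fps_exp (- (2 * \<alpha>))"
    "fps_exp (- (1 - 2 * \<alpha>)) = fps_exp (-1) * fps_exp (2 * \<alpha>)"
    by (simp_all flip: fps_exp_add_mult)
  ultimately show ?thesis by (simp add: algebra_simps) 
qed

section \<open>Consequences of the closed form\<close>

text \<open>
  At \<open>\<alpha> = \<plusminus>1/2\<close> one of the two Pochhammer symbols starts at \<open>0\<close>, so every \<open>a\<^sub>k\<close> with \<open>k \<ge> 1\<close> vanishes.\<close>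

lemma F_diag_eq_1:
  assumes "\<alpha> = 1/2 \<or> \<alpha> = - 1/2"
  shows "F_diag \<alpha> = 1"
proof -
  have a: "a_coef \<alpha> k = (if k = 0 then 1 else 0)" for k
    using assms by (cases k) (auto simp: a_coef_def pochhammer_rec)
  have G: "G_diag \<alpha> n = (if n = 0 then 1 else 0)" for n
    by (auto simp: G_diag_def a intro!: sum.neutral)
  have summand: "fps_nth (F_diag_term \<alpha> n) m = (if n = 0 then (if m = 0 then 1 else 0) else 0)" for n m
    by (auto simp: F_diag_term_def G)
  show ?thesis
    by (rule fps_ext) (simp add: F_diag_nth summand)
qed

lemma fps_exp_minus4_neq_1: "fps_exp (-4) - 1 \<noteq> (0 :: complex fps)"
proof
  assume "fps_exp (-4) - 1 = (0 :: complex fps)"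
  then have "fps_nth (fps_exp (-4) - 1) 1 = (0 :: complex)" by simp
  then show False by simp
qed

text \<open>
  The coefficient of \<open>A\<^sup>k\<close> in \<open>2 cosh 2\<alpha>t = e\<^sup>2\<^sup>\<alpha>\<^sup>t + e\<^sup>-\<^sup>2\<^sup>\<alpha>\<^sup>t\<close>, where \<open>A = \<alpha>\<^sup>2\<close>.\<close>

definition even_exp_coeff :: "nat \<Rightarrow> complex fps" where
  "even_exp_coeff k = fps_const (2 * 2 ^ (2 * k) / fact (2 * k)) * fps_X ^ (2 * k)"

lemma exp_pair_nth:
  assumes "n \<le> N"
  shows "fps_nth (fps_exp (2 * \<alpha>) + fps_exp (- (2 * \<alpha>))) n
    = (\<Sum>k\<le>N. (\<alpha>\<^sup>2) ^ k * fps_nth (even_exp_coeff k) n)"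
proof -
  have nth: "fps_nth (even_exp_coeff k) n = (if n = 2 * k then 2 * 2 ^ n / fact n else 0)" for k
    by (simp add: even_exp_coeff_def fps_X_power_nth)
  show ?thesis
  proof (cases "even n")
    case True
    then obtain j where n: "n = 2 * j" by blast
    with assms have "j \<in> {..N}" by auto
    have "(\<Sum>k\<le>N. (\<alpha>\<^sup>2) ^ k * fps_nth (even_exp_coeff k) n)
        = (\<Sum>k\<le>N. if k = j then (\<alpha>\<^sup>2) ^ j * (2 * 2 ^ n / fact n) else 0)"
      unfolding nth by (intro sum.cong) (auto simp: n)
    also have "\<dots> = (\<alpha>\<^sup>2) ^ j * (2 * 2 ^ n / fact n)"
      using \<open>j \<in> {..N}\<close> by simp
    finally show ?thesis
      by (simp add: n power_mult_distrib flip: power_mult)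
  next
    case False
    then have "fps_nth (even_exp_coeff k) n = 0" for k
      unfolding nth by auto
    with False show ?thesis by simp
  qed
qed

text \<open>
  For fixed \<open>n\<close>, the coefficients of \<open>t\<^sup>n\<close> on the two sides of \<open>Psi_at_functional_equation\<close> are
  polynomials in \<open>A\<close> that agree at every \<open>A = \<alpha>\<^sup>2\<close>, that is, everywhere; hence they have the same
  coefficient of \<open>A\<^sup>k\<close>. For \<open>k \<ge> 1\<close> the part without \<open>\<alpha>\<close> drops out.\<close>

lemma Psi_coeff_eq:
  assumes "k \<ge> 1"
  shows "Psi_coeff k * (fps_exp (-4) - 1) = - fps_exp (-1) * even_exp_coeff k"
proof (rule fps_ext)
  fix n
  define e where "e = fps_exp (-4) - (1 :: complex fps)"
  define P where "P = (\<Sum>i=0..n. smult (fps_nth e (n - i)) (fps_nth Psi i))"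
  define c where "c k = fps_nth (fps_exp (-1) * even_exp_coeff k) n" for k
  define R where "R = [:fps_nth (1 + fps_exp (-2)) n:] - (\<Sum>k\<le>n. monom (c k) k)"
  have "poly P (\<alpha>\<^sup>2) = poly R (\<alpha>\<^sup>2)" for \<alpha>
  proof -
    have "poly P (\<alpha>\<^sup>2) = fps_nth (Psi_at (\<alpha>\<^sup>2) * e) n"
      unfolding P_def fps_mult_nth Psi_at_def by (simp add: poly_sum mult.commute)
    also have "\<dots> = fps_nth (1 + fps_exp (-2)) n
        - fps_nth (fps_exp (-1) * (fps_exp (2 * \<alpha>) + fps_exp (- (2 * \<alpha>)))) n"
      unfolding e_def Psi_at_functional_equation by (simp only: fps_sub_nth)
    also have "fps_nth (fps_exp (-1) * (fps_exp (2 * \<alpha>) + fps_exp (- (2 * \<alpha>)))) n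
        = (\<Sum>i=0..n. fps_nth (fps_exp (-1)) i
             * (\<Sum>k\<le>n. (\<alpha>\<^sup>2) ^ k * fps_nth (even_exp_coeff k) (n - i)))"
      unfolding fps_mult_nth
      by (intro sum.cong refl arg_cong2[of _ _ _ _ "(*)"] exp_pair_nth) auto
    also have "\<dots> = (\<Sum>k\<le>n. (\<alpha>\<^sup>2) ^ k * c k)"
      unfolding c_def fps_mult_nth sum_distrib_left by (subst sum.swap) (simp add: mult_ac)
    also have "fps_nth (1 + fps_exp (-2)) n - \<dots> = poly R (\<alpha>\<^sup>2)"
      by (simp add: R_def poly_sum poly_monom mult.commute)
    finally show ?thesis .
  qed
  then have "poly P ((csqrt A)\<^sup>2) = poly R ((csqrt A)\<^sup>2)" for A by blast
  then have "poly P = poly R" by (intro ext) simp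
  then have "P = R" by (simp only: poly_eq_poly_eq_iff)
  have "c k = 0" if "k > n"
    using that by (auto simp: c_def fps_mult_nth even_exp_coeff_def fps_X_power_nth intro!: sum.neutral)
  then have "coeff R k = - c k"
    using assms by (auto simp: R_def coeff_sum coeff_pCons split: nat.split)
  moreover have "coeff P k = fps_nth (Psi_coeff k * e) n"
    unfolding P_def fps_mult_nth Psi_coeff_def by (simp add: coeff_sum mult.commute)
  ultimately show "fps_nth (Psi_coeff k * (fps_exp (-4) - 1)) n
      = fps_nth (- fps_exp (-1) * even_exp_coeff k) n"
    unfolding \<open>P = R\<close> by (simp add: c_def e_def)
qed

lemma Psi_coeff_rigidity:
  assumes "k \<ge> 1"
  shows "Psi_coeff k = fps_const (2 ^ (2 * k - 1) / fact (2 * k)) * fps_X ^ (2 * k - 2) * Psi_coeff 1"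
proof -
  obtain j where k: "k = Suc j" using assms by (metis Suc_le_D One_nat_def)
  have "even_exp_coeff k = fps_const (2 ^ (2 * k - 1) / fact (2 * k)) * fps_X ^ (2 * k - 2) * even_exp_coeff 1"
  proof -
    have "2 * 2 ^ (2 * k) / fact (2 * k) = 2 ^ (2 * k - 1) / fact (2 * k) * (4 :: complex)"
      by (simp add: k)
    moreover have "fps_X ^ (2 * k) = fps_X ^ (2 * k - 2) * (fps_X\<^sup>2 :: complex fps)"
      by (simp add: k power2_eq_square)
    moreover have "even_exp_coeff 1 = fps_const 4 * fps_X\<^sup>2"
      by (simp add: even_exp_coeff_def)
    ultimately show ?thesis
      unfolding even_exp_coeff_def[of k] by (simp only: fps_const_mult[symmetric] mult_ac)
  qed
  note split = this
  let ?C = "fps_const (2 ^ (2 * k - 1) / fact (2 * k)) * fps_X ^ (2 * k - 2) :: complex fps"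
  have "Psi_coeff k * (fps_exp (-4) - 1) = ?C * (- fps_exp (-1) * even_exp_coeff 1)"
    unfolding Psi_coeff_eq[OF assms] split by (simp only: mult_ac)
  also have "\<dots> = ?C * Psi_coeff 1 * (fps_exp (-4) - 1)"
    unfolding Psi_coeff_eq[OF order_refl, symmetric] by (simp only: mult_ac)
  finally have "Psi_coeff k * (fps_exp (-4) - 1) = ?C * Psi_coeff 1 * (fps_exp (-4) - 1)" .
  then show ?thesis
    using fps_exp_minus4_neq_1 by (simp only: mult_cancel_right) simp
qed

lemma Psi_at_affine_cosh:
  "\<exists>\<Lambda>\<^sub>0 \<Lambda>\<^sub>1 :: complex fls. \<forall>\<alpha> :: complex.
     fps_to_fls (Psi_at (\<alpha>\<^sup>2)) = \<Lambda>\<^sub>1 * fps_to_fls (fps_cosh (2 * \<alpha>)) + \<Lambda>\<^sub>0"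
proof (intro exI allI)
  fix \<alpha> :: complex
  define E where "E = fps_to_fls (fps_exp (-4) - 1 :: complex fps)"
  have "E \<noteq> 0"
    unfolding E_def using fps_exp_minus4_neq_1 by (metis fps_to_fls_eq_0_iff)
  have cosh: "2 * fps_cosh (2 * \<alpha>) = fps_exp (2 * \<alpha>) + fps_exp (- (2 * \<alpha>))"
    by (simp add: fps_cosh_def numeral_fps_const flip: mult.assoc)
  have "Psi_at (\<alpha>\<^sup>2) * (fps_exp (-4) - 1)
     = 1 + fps_exp (-2) - 2 * fps_exp (-1) * fps_cosh (2 * \<alpha>)"
    unfolding Psi_at_functional_equation cosh[symmetric] by (simp only: mult_ac)
  then have "fps_to_fls (Psi_at (\<alpha>\<^sup>2)) * E
     = fps_to_fls (1 + fps_exp (-2)) - fps_to_fls (2 * fps_exp (-1)) * fps_to_fls (fps_cosh (2 * \<alpha>))"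
    unfolding E_def fls_times_fps_to_fls[symmetric] fps_to_fls_minus[symmetric] by (simp only:)
  then have "fps_to_fls (Psi_at (\<alpha>\<^sup>2)) =
      (fps_to_fls (1 + fps_exp (-2)) - fps_to_fls (2 * fps_exp (-1)) * fps_to_fls (fps_cosh (2 * \<alpha>))) / E"
    using \<open>E \<noteq> 0\<close> by (simp only: nonzero_eq_divide_eq not_False_eq_True)
  then show "fps_to_fls (Psi_at (\<alpha>\<^sup>2)) =
      - (fps_to_fls (2 * fps_exp (-1)) / E) * fps_to_fls (fps_cosh (2 * \<alpha>))
      + fps_to_fls (1 + fps_exp (-2)) / E"
    by (simp add: diff_divide_distrib)
qed

lemma Psi_at_quarter: "Psi_at (1/4) = 0"
proof -
  have "Psi_at ((1/2)\<^sup>2) * (fps_exp (-4) - 1) = 0"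
    unfolding Psi_at_functional_equation
    by (simp add: distrib_left fps_exp_add_mult[symmetric])
  then show ?thesis
    using fps_exp_minus4_neq_1 by (simp add: power2_eq_square)
qed

text \<open>
  With \<open>u = e\<^sup>-\<^sup>t\<^sup>/\<^sup>2\<close> and \<open>w = 1/u\<close> the claim is an identity of rational functions of \<open>u\<close>.\<close>

lemma Psi_at_0:
  "Psi_at 0 = fps_const (1/2) * (inverse (fps_cosh 1) - fps_sinh (1/2) / fps_cosh (1/2) - 1)"
proof -
  define h u :: "complex fps" where "h = fps_const (1/2)" and "u = fps_exp (- (1/2))"
  define w where "w = (fps_exp (1/2) :: complex fps)"
  have uw: "u * w = 1" by (simp add: u_def w_def flip: fps_exp_add_mult)
  have h: "2 * h = 1" by (simp add: h_def numeral_fps_const)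
  have e: "fps_exp 1 = w\<^sup>2" "fps_exp (-1) = u\<^sup>2" "fps_exp (-2) = u ^ 4" "fps_exp (-4) = u ^ 8"
    by (simp_all add: u_def w_def fps_exp_power_mult)
  have C: "fps_cosh 1 = h * (w\<^sup>2 + u\<^sup>2)" "fps_cosh (1/2) = h * (w + u)"
    "fps_sinh (1/2) = h * (w - u)"
    by (simp_all add: fps_cosh_def fps_sinh_def h_def u_def w_def e)
  define I J where "I = inverse (fps_cosh 1)" and "J = inverse (fps_cosh (1/2))"
  have IJ: "I * fps_cosh 1 = 1" "J * fps_cosh (1/2) = 1"
    unfolding I_def J_def by (intro inverse_mult_eq_1; simp add: fps_cosh_def)+
  have div: "fps_sinh (1/2) / fps_cosh (1/2) = fps_sinh (1/2) * J"
    unfolding J_def by (rule fps_divide_unit) (simp add: fps_cosh_def)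
  have "Psi_at (0\<^sup>2) * (u ^ 8 - 1) = 1 + u ^ 4 - u\<^sup>2 * 2"
    unfolding Psi_at_functional_equation[of 0, unfolded e] by simp
  moreover have "h * (I - fps_sinh (1/2) * J - 1) * (u ^ 8 - 1) = 1 + u ^ 4 - u\<^sup>2 * 2"
  proof -
    have I: "I * (1 + u ^ 4) = 2 * u\<^sup>2"
      using IJ(1) uw h unfolding C by algebra
    have J: "h * (w - u) * J * (1 + u\<^sup>2) = 1 - u\<^sup>2"
      using IJ(2) uw h unfolding C by algebra
    show ?thesis
      unfolding C using I J h by algebra
  qed
  ultimately have "Psi_at 0 * (u ^ 8 - 1) = h * (I - fps_sinh (1/2) * J - 1) * (u ^ 8 - 1)"
    by simp
  moreover have "u ^ 8 - 1 \<noteq> 0"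
    using fps_exp_minus4_neq_1 by (simp add: e)
  ultimately show ?thesis
    unfolding div by (simp add: h_def I_def)
qed

theorem corollary1p3:
  "((\<exists>\<Lambda>\<^sub>0 \<Lambda>\<^sub>1 :: complex fls. \<forall>\<alpha> :: complex.
       fps_to_fls (Psi_at (\<alpha>\<^sup>2)) = \<Lambda>\<^sub>1 * fps_to_fls (fps_cosh (2 * \<alpha>)) + \<Lambda>\<^sub>0)
    \<and> (\<forall>k\<ge>1. Psi_coeff k =
         fps_const (2 ^ (2 * k - 1) / fact (2 * k)) * fps_X ^ (2 * k - 2) * Psi_coeff 1))
   \<and> (Psi_at (1/4) = 0 \<and> F_diag (1/2) = 1 \<and> F_diag (- 1/2) = 1)
   \<and> Psi_at 0 = fps_const (1/2) * (inverse (fps_cosh 1) - fps_sinh (1/2) / fps_cosh (1/2) - 1)"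
proof (intro conjI allI impI)
  show "Psi_coeff k = fps_const (2 ^ (2 * k - 1) / fact (2 * k)) * fps_X ^ (2 * k - 2) * Psi_coeff 1"
    if "1 \<le> k" for k
    using that by (rule Psi_coeff_rigidity)
qed (simp_all only: Psi_at_affine_cosh Psi_at_quarter Psi_at_0 F_diag_eq_1 simp_thms)

end
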